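(* Let $m\ge 0$ and $p_1,\ldots,p_m\ge 3$ be integers, let $G\in\mathrm{CP}(2:p_1,\ldots,p_m)$ and $n=|V(G)|$. Then $\operatorname{cof}(\mathcal{D}(G))=(-1)^{n-1}n$.
   Context: A sequence of integers $q_1,\ldots,q_n$ ($n\ge 2$) is non-leaping if $q_1=0$, $q_2=1$, and $2\le q_k\le q_{k-1}+1$ for $k=3,\ldots,n$. Set $b_k=k-q_k+1$ for $k\ge 3$. A neighborhood sequence of $s$ is a sequence of sets $W_1=\varnothing$, $W_2=\{1\}$, and for $k\ge3$, $W_k=\{a_k\}\cup\{b_k,\ldots,k-1\}$ where $a_k\in W_{k-1}$ and $a_k<b_k$. Its graph has vertex set $\{1,\ldots,n\}$ with vertex $k$ joined to every vertex of $W_k$. $\mathrm{CP}(s)$ is the family of graphs of all neighborhood sequences of $s$. For integers $p_1,\ldots,p_m\ge3$, $2:p_1,\ldots,p_m$ denotes the non-leaping sequence $0,1,2,\ldots,p_1-1,2,\ldots,p_2-1,\ldots,2,\ldots,p_m-1$ (for $m=0$ it is $0,1$). $\mathcal{D}(G)$ is the distance matrix. For a square matrix $M$, $\operatorname{cof}(M)=\sum_{i,j}(-1)^{i+j}\det M(i|j)$ is the sum of all cofactors, where $M(i|j)$ deletes row $i$ and column $j$. *)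

theory Defs
  imports "Graph_Theory.Shortest_Path" "Graph_Theory.Pair_Digraph" "Jordan_Normal_Form.Determinant"
begin

text \<open>
  Sequences are 1-indexed in the mathematics; lists are 0-indexed, so the list \<open>s\<close> encodes
  $q_k$ as \<open>s ! (k - 1)\<close> for $1 \le k \le$ \<open>length s\<close>. The entries of a non-leaping sequence are
  nonnegative by definition, so natural numbers suffice.
\<close>

definition seq_entry :: "nat list \<Rightarrow> nat \<Rightarrow> nat" where
  "seq_entry s k = s ! (k - 1)"

definition non_leaping :: "nat list \<Rightarrow> bool" where
  "non_leaping s \<longleftrightarrow> 2 \<le> length s \<and> seq_entry s 1 = 0 \<and> seq_entry s 2 = 1 \<and>
     (\<forall>k\<in>{3..length s}. 2 \<le> seq_entry s k \<and> seq_entry s k \<le> seq_entry s (k - 1) + 1)"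

text \<open>
  $b_k = k - q_k + 1$. In a non-leaping sequence $q_k < k$ (lemma \<open>non_leaping_less\<close> below), so
  the subtraction on natural numbers does not truncate.
\<close>

definition seq_b :: "nat list \<Rightarrow> nat \<Rightarrow> nat" where
  "seq_b s k = k + 1 - seq_entry s k"

text \<open>Only the values \<open>W 1, \<dots>, W (length s)\<close> are relevant.\<close>

definition neighborhood_sequence :: "nat list \<Rightarrow> (nat \<Rightarrow> nat set) \<Rightarrow> bool" where
  "neighborhood_sequence s W \<longleftrightarrow> non_leaping s \<and> W 1 = {} \<and> W 2 = {1} \<and>
     (\<forall>k\<in>{3..length s}. \<exists>a. a \<in> W (k - 1) \<and> a < seq_b s k \<and> W k = {a} \<union> {seq_b s k..k - 1})"

text \<open>
  Undirected simple graphs are represented, as usual in \<open>Graph_Theory\<close>, by loop-free symmetric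
  digraphs (\<open>pair_graph\<close>).
\<close>

definition neighborhood_graph :: "nat \<Rightarrow> (nat \<Rightarrow> nat set) \<Rightarrow> nat pair_pre_digraph" where
  "neighborhood_graph n W =
     \<lparr> pverts = {1..n},
       parcs = {(k, j) | k j. k \<in> {1..n} \<and> j \<in> W k} \<union> {(j, k) | k j. k \<in> {1..n} \<and> j \<in> W k} \<rparr>"

definition CP :: "nat list \<Rightarrow> nat pair_pre_digraph set" where
  "CP s = {neighborhood_graph (length s) W | W. neighborhood_sequence s W}"

text \<open>The sequence $2 : p_1, \ldots, p_m$.\<close>

definition two_seq :: "nat list \<Rightarrow> nat list" where
  "two_seq ps = [0, 1] @ concat (map (\<lambda>p. [2..<p]) ps)"

text \<open>
  The distance is the infimum of the lengths of all walks, i.e.\ the shortest-path cost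
  for unit arc weights. For unreachable vertices the library value is \<open>\<infinity>\<close>, which
  \<open>real_of_ereal\<close> maps to 0; graphs in \<open>CP s\<close> are connected, so this does not occur for them.
\<close>

definition graph_distance :: "'a pair_pre_digraph \<Rightarrow> 'a \<Rightarrow> 'a \<Rightarrow> real" where
  "graph_distance G u v = real_of_ereal (wf_digraph.\<mu> (with_proj G) (\<lambda>_. 1) u v)"

text \<open>
  For graphs with vertex set $\{1, \ldots, n\}$; matrix indices start at 0.
\<close>

definition distance_matrix :: "nat pair_pre_digraph \<Rightarrow> real mat" where
  "distance_matrix G =
     mat (card (pverts G)) (card (pverts G)) (\<lambda>(i, j). graph_distance G (i + 1) (j + 1))"

text \<open>
  For square \<open>A\<close>; \<open>cofactor A i j = (-1) ^ (i + j) * det (mat_delete A i j)\<close>, whose sign is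
  unaffected by shifting both indices by 1.
\<close>

definition cof :: "'a :: comm_ring_1 mat \<Rightarrow> 'a" where
  "cof A = (\<Sum>i<dim_row A. \<Sum>j<dim_col A. cofactor A i j)"

lemma non_leaping_less:
  assumes "non_leaping s" "1 \<le> k" "k \<le> length s"
  shows "seq_entry s k < k"
  using assms(2,3)
proof (induction k rule: dec_induct)
  case base
  then show ?case using assms(1) by (simp add: non_leaping_def)
next
  case (step k)
  show ?case
  proof (cases "k = 1")
    case True
    then show ?thesis using assms(1) by (simp add: non_leaping_def numeral_2_eq_2)
  next
    case False
    with step.hyps step.prems have "Suc k \<in> {3..length s}" by auto
    with assms(1) have "seq_entry s (Suc k) \<le> seq_entry s k + 1"
      unfolding non_leaping_def by fastforce
    with step show ?thesis by simp
  qed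
qed

lemma neighborhood_sequence_subset:
  assumes "neighborhood_sequence s W" "1 \<le> k" "k \<le> length s"
  shows "W k \<subseteq> {1..<k}"
  using assms(2,3)
proof (induction k rule: dec_induct)
  case base
  then show ?case using assms(1) by (simp add: neighborhood_sequence_def)
next
  case (step k)
  show ?case
  proof (cases "k = 1")
    case True
    then show ?thesis using assms(1) by (simp add: neighborhood_sequence_def numeral_2_eq_2)
  next
    case False
    with step.hyps step.prems have k: "Suc k \<in> {3..length s}" by auto
    with assms(1) obtain a where a: "a \<in> W k" "W (Suc k) = {a} \<union> {seq_b s (Suc k)..k}"
      unfolding neighborhood_sequence_def by fastforce
    have "seq_entry s (Suc k) < Suc k"
      using non_leaping_less assms(1) k by (simp add: neighborhood_sequence_def)
    then have "1 \<le> seq_b s (Suc k)" by (simp add: seq_b_def)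
    with a step show ?thesis by fastforce
  qed
qed

lemma CP_pair_graph:
  assumes "G \<in> CP s"
  shows "pair_graph G" "pverts G = {1..length s}"
proof -
  from assms obtain W where W: "neighborhood_sequence s W"
    and G: "G = neighborhood_graph (length s) W" by (auto simp: CP_def)
  have sub: "j \<in> {1..<k}" if "k \<in> {1..length s}" "j \<in> W k" for j k
    using neighborhood_sequence_subset[OF W, of k] that by auto
  show pv: "pverts G = {1..length s}" by (simp add: G neighborhood_graph_def)
  have sub2: "parcs G \<subseteq> pverts G \<times> pverts G"
    using sub by (fastforce simp: G neighborhood_graph_def)
  have "finite (parcs G)" using finite_subset[OF sub2] pv by simp
  moreover have "fst e \<noteq> snd e" if "e \<in> parcs G" for e
    using that sub by (fastforce simp: G neighborhood_graph_def)
  moreover have "symmetric (with_proj G)"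
    by (auto simp: symmetric_def sym_def G neighborhood_graph_def)
  ultimately show "pair_graph G"
    using sub2 pv by unfold_locales auto
qed

lemma non_leaping_snoc:
  assumes "non_leaping s" "2 \<le> q" "q \<le> last s + 1"
  shows "non_leaping (s @ [q])"
proof -
  have "s \<noteq> []" using assms(1) by (auto simp: non_leaping_def)
  moreover have "k = Suc (length s)" if "k \<le> Suc (length s)" "\<not> k - Suc 0 < length s" for k
    using that \<open>s \<noteq> []\<close> by (cases s) auto
  ultimately show ?thesis using assms
    by (fastforce simp: non_leaping_def seq_entry_def nth_append last_conv_nth)
qed

lemma non_leaping_append_upt:
  assumes "non_leaping s" "1 \<le> last s" "p \<ge> 2"
  shows "non_leaping (s @ [2..<p]) \<and> 1 \<le> last (s @ [2..<p])"
  using assms(3)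
proof (induction p rule: dec_induct)
  case base
  then show ?case using assms by simp
next
  case (step p)
  have "p \<le> last (s @ [2..<p]) + 1"
    using assms(2) step.hyps by (cases "p = 2") (auto simp: last_append)
  with step non_leaping_snoc[of "s @ [2..<p]" p] show ?case by simp
qed

lemma non_leaping_two_seq:
  assumes "\<forall>p\<in>set ps. 3 \<le> p"
  shows "non_leaping (two_seq ps)"
proof -
  have "non_leaping (two_seq ps) \<and> 1 \<le> last (two_seq ps)"
    using assms
  proof (induction ps rule: rev_induct)
    case Nil
    then show ?case by (simp add: two_seq_def non_leaping_def seq_entry_def)
  next
    case (snoc p ps)
    have "two_seq (ps @ [p]) = two_seq ps @ [2..<p]" by (simp add: two_seq_def)
    with snoc non_leaping_append_upt[of "two_seq ps" p] show ?case by simp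
  qed
  then show ?thesis ..
qed

end

theory Submission
  imports Defs
begin

text \<open>
  Write $d$ for the distance in $G$. Adding the vertex $k$ to the graph on $1, \dots, k - 1$
  preserves distances, and there is an earlier neighbour $c$ of $k$ such that
  $d(k,u) = d(c,u) + \sigma + \tau [u = k - 1]$ for all $u < k$, where
  $(c,\sigma,\tau) = (k - 1, 0, 1)$ if $k$ enlarges the current clique, and
  $(c,\sigma,\tau) = (a_k, 1, -1)$ if $k$ starts a new one.

  The sum of cofactors of $D$ is minus the determinant of $D$ bordered by a row and a column of
  ones. Subtracting the row of $c$ and $\sigma$ times the border row from the row of $k$, and
  likewise for columns, leaves only the entries $\tau$ at $k - 1$ and $-2$ on the diagonal.
  As $\tau^2 = 1$, the bordered determinants satisfy $\Delta_k = -2\Delta_{k-1} - \Delta_{k-2}$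
  with $\Delta_0 = 0$ and $\Delta_1 = -1$, hence $\Delta_n = (-1)^n n$.
\<close>

subsection \<open>Bordered determinants\<close>

text \<open>Two elementary row operations; in the application \<open>l\<close> is the vertex
  \<open>c\<close> and \<open>m = 0\<close> is the border row.\<close>

lemma det_mat_sub_rows:
  fixes B :: "nat \<Rightarrow> nat \<Rightarrow> 'a::comm_ring_1"
  assumes "l < n" "m < n" "k \<noteq> l" "k \<noteq> m"
  shows "det (mat n n (\<lambda>(i, j). if i = k then B i j - B l j - s * B m j else B i j))
       = det (mat n n (\<lambda>(i, j). B i j))"
proof -
  have "mat n n (\<lambda>(i, j). if i = k then B i j - B l j - s * B m j else B i j)
      = addrow (- s) k m (addrow (- 1) k l (mat n n (\<lambda>(i, j). B i j)))"
    using assms by (intro eq_matI) (auto simp: mat_addrow_def)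
  also have "det \<dots> = det (mat n n (\<lambda>(i, j). B i j))"
    using assms by (simp add: det_addrow[where n = n])
  finally show ?thesis .
qed

lemma det_mat_sub_cols:
  fixes B :: "nat \<Rightarrow> nat \<Rightarrow> 'a::comm_ring_1"
  assumes "l < n" "m < n" "k \<noteq> l" "k \<noteq> m"
  shows "det (mat n n (\<lambda>(i, j). if j = k then B i j - B i l - s * B i m else B i j))
       = det (mat n n (\<lambda>(i, j). B i j))"
proof -
  have "mat n n (\<lambda>(i, j). if j = k then B i j - B i l - s * B i m else B i j)
      = addcol (- s) k m (addcol (- 1) k l (mat n n (\<lambda>(i, j). B i j)))"
    using assms by (intro eq_matI) (auto simp: mat_addcol_def)
  also have "det \<dots> = det (mat n n (\<lambda>(i, j). B i j))"
    using assms by (simp add: det_addcol[where n = n] carrier_matI)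
  finally show ?thesis .
qed

text \<open>Expand along the last row, then expand the minor of its entry at \<open>n\<close> along
  that minor's last column, where only \<open>B n (Suc n)\<close> survives.\<close>

lemma det_tridiagonal_corner:
  fixes B :: "nat \<Rightarrow> nat \<Rightarrow> 'a::comm_ring_1"
  assumes row: "\<And>j. j < n \<Longrightarrow> B (Suc n) j = 0"
    and col: "\<And>i. i < n \<Longrightarrow> B i (Suc n) = 0"
  defines "M \<equiv> \<lambda>k. mat k k (\<lambda>(i, j). B i j)"
  shows "det (M (Suc (Suc n))) =
    B (Suc n) (Suc n) * det (M (Suc n)) - B (Suc n) n * B n (Suc n) * det (M n)"
proof -
  let ?A = "M (Suc (Suc n))"
  have A: "?A \<in> carrier_mat (Suc (Suc n)) (Suc (Suc n))" by (simp add: M_def)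
  have "mat_delete ?A (Suc n) (Suc n) = M (Suc n)"
    by (rule eq_matI) (auto simp: M_def mat_delete_def)
  then have c1: "cofactor ?A (Suc n) (Suc n) = det (M (Suc n))" by (simp add: cofactor_def)
  \<comment> \<open>Deleting column \<open>n\<close> moves the old column \<open>Suc n\<close> to
    index \<open>n\<close>.\<close>
  define C where "C = mat_delete ?A (Suc n) n"
  have C: "C \<in> carrier_mat (Suc n) (Suc n)" by (simp add: C_def M_def carrier_matI)
  have Ccol: "C $$ (i, n) = (if i = n then B n (Suc n) else 0)" if "i < Suc n" for i
    using that col[of i] by (auto simp: C_def M_def mat_delete_def)
  have "mat_delete C n n = M n"
    by (rule eq_matI) (auto simp: C_def M_def mat_delete_def)
  then have "cofactor C n n = det (M n)" by (simp add: cofactor_def)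
  then have "det C = B n (Suc n) * det (M n)"
    using laplace_expansion_column[OF C, of n] by (simp add: Ccol)
  then have c2: "cofactor ?A (Suc n) n = - (B n (Suc n) * det (M n))"
    by (simp add: cofactor_def C_def[symmetric])
  have "det ?A = (\<Sum>j<Suc (Suc n). B (Suc n) j * cofactor ?A (Suc n) j)"
    using laplace_expansion_row[OF A, of "Suc n"] by (simp add: M_def)
  also have "\<dots> = B (Suc n) n * cofactor ?A (Suc n) n
      + B (Suc n) (Suc n) * cofactor ?A (Suc n) (Suc n)"
    using row by simp
  finally show ?thesis by (simp add: c1 c2)
qed

text \<open>The border comes first, so that vertex \<open>k\<close> occupies index \<open>k\<close>
  and matrix indices agree with the 1-based vertices.\<close>

definition bordered :: "'a::comm_ring_1 mat \<Rightarrow> 'a mat" where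
  "bordered A = mat (Suc (dim_row A)) (Suc (dim_col A)) (\<lambda>(i, j).
     if i = 0 then (if j = 0 then 0 else 1) else if j = 0 then 1 else A $$ (i - 1, j - 1))"

text \<open>Expanding along the border row and then along the border column reaches exactly the
  minors of \<open>A\<close>. The shift of the column index by one produces the minus sign.\<close>

lemma cof_eq_det_bordered:
  fixes A :: "'a::comm_ring_1 mat"
  assumes A: "A \<in> carrier_mat n n"
  shows "cof A = - det (bordered A)"
proof -
  let ?N = "bordered A"
  have N: "?N \<in> carrier_mat (Suc n) (Suc n)" using A by (simp add: bordered_def)
  have minor: "det (mat_delete ?N 0 (Suc j)) = (\<Sum>i<n. (-1) ^ i * det (mat_delete A i j))"
    if j: "j < n" for j
  proof -
    let ?C = "mat_delete ?N 0 (Suc j)"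
    have C: "?C \<in> carrier_mat n n" using N by (intro carrier_matI) auto
    have "0 < n" using j by simp
    have "mat_delete ?C i 0 = mat_delete A i j" if "i < n" for i
      using A j that by (intro eq_matI) (auto simp: bordered_def mat_delete_def)
    then have "cofactor ?C i 0 = (-1) ^ i * det (mat_delete A i j)" if "i < n" for i
      using that by (simp add: cofactor_def)
    moreover have "?C $$ (i, 0) = 1" if "i < n" for i
      using A j that by (auto simp: bordered_def mat_delete_def)
    ultimately show ?thesis using laplace_expansion_column[OF C \<open>0 < n\<close>] by simp
  qed
  have "det ?N = (\<Sum>j<Suc n. ?N $$ (0, j) * cofactor ?N 0 j)"
    using laplace_expansion_row[OF N, of 0] by simp
  also have "\<dots> = (\<Sum>j<n. cofactor ?N 0 (Suc j))"
    using A by (simp add: sum.lessThan_Suc_shift bordered_def del: sum.lessThan_Suc)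
  also have "\<dots> = - (\<Sum>j<n. \<Sum>i<n. cofactor A i j)"
    by (simp add: cofactor_def minor sum_distrib_left sum_negf power_add algebra_simps)
  also have "(\<Sum>j<n. \<Sum>i<n. cofactor A i j) = cof A"
    using A by (subst sum.swap) (simp add: cof_def)
  finally show ?thesis by simp
qed

lemma det_bordered_step:
  fixes B :: "nat \<Rightarrow> nat \<Rightarrow> 'a::comm_ring_1"
  assumes sym: "\<And>i j. B i j = B j i"
    and border: "B 0 0 = 0" "\<And>i. 0 < i \<Longrightarrow> B i 0 = 1"
    and diag: "\<And>i. B i i = 0"
    and c: "0 < c" "c \<le> n" "B (Suc n) c = 1"
    and rel: "\<And>u. 0 < u \<Longrightarrow> u \<le> n \<Longrightarrow> B (Suc n) u = B c u + s + (if u = n then t else 0)"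
    and t: "t * t = 1"
  defines "M \<equiv> \<lambda>k. mat k k (\<lambda>(i, j). B i j)"
  shows "det (M (Suc (Suc n))) = - 2 * det (M (Suc n)) - det (M n)"
proof -
  let ?k = "Suc n"
  \<comment> \<open>\<open>R\<close> is \<open>B\<close> after the row operations at the new vertex,
    \<open>T\<close> is \<open>R\<close> after the matching column operations.\<close>
  define R where "R i j = (if i = ?k then B i j - B c j - s * B 0 j else B i j)" for i j
  define T where "T i j = (if j = ?k then R i j - R i c - s * R i 0 else R i j)" for i j
  define MT where "MT k = mat k k (\<lambda>(i, j). T i j)" for k
  have n: "0 < n" using c by simp
  have B0: "B 0 j = 1" if "0 < j" for j using border(2)[OF that] sym[of 0 j] by simp
  have R: "R ?k j = (if j = n then t else 0)" if "j < ?k" for j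
    using that rel[of j] c n border B0 by (cases "j = 0") (auto simp: R_def)
  have T_row: "T ?k j = (if j = n then t else 0)" if "j < ?k" for j
    using R that by (simp add: T_def)
  have T_col: "T j ?k = (if j = n then t else 0)" if "j < ?k" for j
  proof -
    \<comment> \<open>Row \<open>j\<close> is untouched by the row operations, so symmetry of
      \<open>B\<close> turns the column operation into the row operation.\<close>
    have "T j ?k = R ?k j"
      using that by (simp add: T_def R_def sym[of j])
    then show ?thesis using R that by simp
  qed
  \<comment> \<open>Here \<open>R ?k ?k = -1 - s\<close>, \<open>R ?k c = 1 - s\<close> and
    \<open>R ?k 0 = 0\<close>, so \<open>s\<close> cancels.\<close>
  have T_corner: "T ?k ?k = - 2"
    using c border B0 by (simp add: T_def R_def diag sym[of c])
  have small: "MT k = M k" if "k \<le> ?k" for k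
    using that by (intro eq_matI) (auto simp: MT_def M_def T_def R_def)
  have "det (M (Suc ?k)) = det (mat (Suc ?k) (Suc ?k) (\<lambda>(i, j). R i j))"
    unfolding M_def R_def using c by (subst det_mat_sub_rows) auto
  also have "\<dots> = det (MT (Suc ?k))"
    unfolding MT_def T_def using c by (subst det_mat_sub_cols) auto
  also have "\<dots> = T ?k ?k * det (MT ?k) - T ?k n * T n ?k * det (MT n)"
    unfolding MT_def by (rule det_tridiagonal_corner) (simp_all add: T_row T_col)
  also have "\<dots> = - 2 * det (M ?k) - det (M n)"
    using T_row[of n] T_col[of n] by (simp add: T_corner small t)
  finally show ?thesis .
qed

text \<open>Separates the linear algebra from the graph theory: graphs enter only through the
  triples \<open>c\<close>, \<open>s\<close>, \<open>t\<close>.\<close>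

lemma cof_of_row_recurrence:
  fixes d :: "nat \<Rightarrow> nat \<Rightarrow> 'a::comm_ring_1"
  assumes sym: "\<And>i j. d i j = d j i"
    and diag: "\<And>i. d i i = 0"
    and step: "\<And>k. 2 \<le> k \<Longrightarrow> k \<le> n \<Longrightarrow> \<exists>c s t. 1 \<le> c \<and> c < k \<and> d k c = 1 \<and> t * t = 1 \<and>
      (\<forall>u\<in>{1..<k}. d k u = d c u + s + (if u = k - 1 then t else 0))"
    and n: "1 \<le> n"
  shows "cof (mat n n (\<lambda>(i, j). d (i + 1) (j + 1))) = (- 1) ^ (n - 1) * of_nat n"
proof -
  define B where "B i j = (if i = 0 then if j = 0 then 0 else 1
    else if j = 0 then 1 else d i j)" for i j
  define M where "M k = mat k k (\<lambda>(i, j). B i j)" for k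
  have *: "det (M (Suc k)) = (- 1) ^ k * of_nat k" if "k \<le> n" for k
    using that
  proof (induction k rule: less_induct)
    case (less k)
    \<comment> \<open>The recurrence has order two, so the border alone (determinant 0) and the
      border with one vertex (determinant -1) are the base cases.\<close>
    consider "k = 0" | "k = 1" | m where "k = Suc m" "1 \<le> m"
      by (metis One_nat_def Suc_leI not0_implies_Suc not_gr0)
    then show ?case
    proof cases
      case 1
      then show ?thesis by (simp add: M_def B_def det_single)
    next
      case 2
      then show ?thesis
        using det_tridiagonal_corner[of 0 B] by (simp add: M_def B_def det_single diag)
    next
      case (3 m)
      with step[of k] less.prems obtain c s t where cst: "1 \<le> c" "c < k" "d k c = 1" "t * t = 1"
        "\<forall>u\<in>{1..<k}. d k u = d c u + s + (if u = k - 1 then t else 0)"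
        by auto
      have "det (M (Suc (Suc m))) = - 2 * det (M (Suc m)) - det (M m)"
        unfolding M_def
        by (rule det_bordered_step[where c = c and s = s and t = t])
          (use cst 3 in \<open>auto simp: B_def diag sym\<close>)
      moreover obtain l where "m = Suc l" using 3 by (cases m) auto
      moreover from calculation have
        "det (M (Suc m)) = (- 1) ^ m * of_nat m" "det (M m) = (- 1) ^ l * of_nat l"
        using less.IH[of m] less.IH[of l] less.prems 3 by auto
      ultimately show ?thesis
        using 3 by (simp only:) (simp add: algebra_simps)
    qed
  qed
  let ?A = "mat n n (\<lambda>(i, j). d (i + 1) (j + 1))"
  have "bordered ?A = M (Suc n)"
    by (rule eq_matI) (auto simp: bordered_def M_def B_def)
  then have "cof ?A = - det (M (Suc n))"
    using cof_eq_det_bordered[of ?A n] by simp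
  then show ?thesis using *[of n] n by (cases n) auto
qed

subsection \<open>Distances in clique paths\<close>

text \<open>A potential falls by at most one per arc. With the candidate distance to
  \<open>v\<close> as \<open>h\<close>, this shows that no walk is shorter than claimed.\<close>

lemma (in wf_digraph) potential_le_awalk_length:
  fixes h :: "'a \<Rightarrow> nat"
  assumes "\<And>e. e \<in> arcs G \<Longrightarrow> h (tail G e) \<le> h (head G e) + 1"
    and "awalk u p v"
  shows "h u \<le> h v + length p"
  using assms(2)
proof (induction p arbitrary: u)
  case Nil
  then show ?case by (simp add: awalk_Nil_iff)
next
  case (Cons e p)
  then show ?case using assms(1)[of e] by (fastforce simp: awalk_Cons_iff)
qed

text \<open>With unit weights cost is length; the given walk bounds the infimum from above, the last
  hypothesis from below.\<close>

lemma (in wf_digraph) \<mu>_unit_eqI: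
  assumes "awalk u p v" "length p = m" "\<And>q. awalk u q v \<Longrightarrow> m \<le> length q"
  shows "real_of_ereal (\<mu> (\<lambda>_. 1) u v) = real m"
proof -
  have cost: "awalk_cost (\<lambda>_. 1) q = real (length q)" for q
    by (induction q) simp_all
  have "\<mu> (\<lambda>_. 1) u v = ereal (real m)"
  proof (rule antisym)
    show "\<mu> (\<lambda>_. 1) u v \<le> ereal (real m)"
      using min_cost_le_walk_cost[OF assms(1), of "\<lambda>_. 1"] assms(2) by (simp add: cost)
    show "ereal (real m) \<le> \<mu> (\<lambda>_. 1) u v"
      unfolding \<mu>_def using assms(3) by (intro INF_greatest) (simp add: cost)
  qed
  then show ?thesis by simp
qed


text \<open>
  Within a run \<open>2, \<dots>, p - 1\<close> the value $b_k$ is constant, so a new vertex \<open>k\<close> either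
  becomes an adjacent twin of \<open>k - 1\<close>, or starts a new clique on an edge at \<open>k - 1\<close>.
\<close>

locale clique_path =
  fixes n :: nat and W :: "nat \<Rightarrow> nat set"
  assumes W1: "W 1 = {}" and W2: "W 2 = {1}"
    and W_step: "\<And>k. 3 \<le> k \<Longrightarrow> k \<le> n \<Longrightarrow>
      W k = insert (k - 1) (W (k - 1)) \<or> (\<exists>a\<in>W (k - 1). W k = {a, k - 1})"
begin

section \<open>Neighborhoods: cliques, anchors and gaps\<close>

lemma W_cases [consumes 2, case_names two twin new]:
  assumes "2 \<le> k" "k \<le> n"
  obtains "k = 2" "W k = {1}"
  | "3 \<le> k" "W k = insert (k - 1) (W (k - 1))"
  | a where "3 \<le> k" "a \<in> W (k - 1)" "W k = {a, k - 1}"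
proof (cases "k = 2")
  case True then show ?thesis using W2 that by simp
next
  case False then show ?thesis using W_step[of k] assms that by force
qed

lemma W_subset: "1 \<le> k \<Longrightarrow> k \<le> n \<Longrightarrow> W k \<subseteq> {1..<k}"
proof (induction k rule: dec_induct)
  case base then show ?case using W1 by auto
next
  case (step k)
  then have "2 \<le> Suc k" "Suc k \<le> n" by auto
  then show ?case using step by (cases rule: W_cases) (fastforce+)
qed

lemma W_pos_less: "j \<in> W k \<Longrightarrow> 1 \<le> k \<Longrightarrow> k \<le> n \<Longrightarrow> 1 \<le> j \<and> j < k"
  using W_subset[of k] by auto

lemma pred_in_W:
  assumes "2 \<le> k" "k \<le> n"
  shows "k - 1 \<in> W k"
  using assms by (cases rule: W_cases) auto

lemma W_pred:
  assumes "2 \<le> k" "k \<le> n" "x \<in> W k" "x \<noteq> k - 1"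
  shows "x \<in> W (k - 1)"
  using assms by (cases rule: W_cases) auto

text \<open>Earlier neighbours of \<open>Suc k\<close> other than \<open>k\<close> are already in
  \<open>W k\<close>. So either \<open>y = k\<close>, or both vertices lie in \<open>W k\<close> and
  induction applies.\<close>

lemma W_clique:
  assumes "1 \<le> k" "k \<le> n" "x \<in> W k" "y \<in> W k" "x < y"
  shows "x \<in> W y"
  using assms
proof (induction k rule: dec_induct)
  case base then show ?case using W1 by auto
next
  case (step k)
  have k: "2 \<le> Suc k" "Suc k \<le> n" using step by auto
  have "x < y" "y < Suc k" using step W_pos_less[of y "Suc k"] by auto
  then have x: "x \<in> W k" using W_pred[OF k] step.prems by simp
  show ?case
  proof (cases "y = k")
    case False
    then have "y \<in> W k" using W_pred[OF k] step.prems by simp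
    then show ?thesis using step x by simp
  qed (use x in simp)
qed

text \<open>For a new clique this is $a_k$, and twins inherit it. A shortest path from
  \<open>k\<close> to an earlier non-neighbour can leave through it.\<close>

definition anchor :: "nat \<Rightarrow> nat" where
  "anchor k = Min (W k)"

lemma
  assumes "2 \<le> k" "k \<le> n"
  shows anchor_in: "anchor k \<in> W k" and anchor_le: "\<And>x. x \<in> W k \<Longrightarrow> anchor k \<le> x"
    and anchor_bounds: "1 \<le> anchor k" "anchor k < k"
proof -
  have fin: "finite (W k)" using W_subset[of k] assms by (meson finite_atLeastLessThan finite_subset le_trans one_le_numeral)
  then show in_: "anchor k \<in> W k" using pred_in_W assms unfolding anchor_def by (intro Min_in) auto
  show "\<And>x. x \<in> W k \<Longrightarrow> anchor k \<le> x" using fin by (simp add: anchor_def)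
  show "1 \<le> anchor k" "anchor k < k" using W_pos_less[OF in_] assms by auto
qed

lemma anchor_twin:
  assumes "3 \<le> k" "k \<le> n" "W k = insert (k - 1) (W (k - 1))"
  shows "anchor k = anchor (k - 1)"
proof -
  have k: "2 \<le> k - 1" "k - 1 \<le> n" using assms by auto
  show ?thesis
  proof (rule antisym)
    have k2: "2 \<le> k" using assms by simp
    have "anchor (k - 1) \<in> W k" using anchor_in[OF k] assms(3) by simp
    then show "anchor k \<le> anchor (k - 1)" by (rule anchor_le[OF k2 assms(2)])
    have "anchor k = k - 1 \<or> anchor k \<in> W (k - 1)"
      using anchor_in[OF k2 assms(2)] assms(3) by simp
    then show "anchor (k - 1) \<le> anchor k"
      using anchor_le[OF k] anchor_bounds[OF k] by auto
  qed
qed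

lemma anchor_new:
  assumes "3 \<le> k" "k \<le> n" "a \<in> W (k - 1)" "W k = {a, k - 1}"
  shows "anchor k = a" "a < k - 1"
proof -
  show a: "a < k - 1" using W_pos_less[OF assms(3)] assms by auto
  then show "anchor k = a"
    using anchor_in[of k] anchor_le[of k a] assms by auto
qed

text \<open>Apart from its anchor, \<open>W k\<close> is an interval ending at \<open>k - 1\<close>;
  only the anchor can have a non-neighbour between itself and \<open>k\<close>.\<close>

lemma W_gap:
  assumes "1 \<le> k" "k \<le> n" "j \<in> W k" "j < i" "i < k" "i \<notin> W k"
  shows "j = anchor k"
  using assms
proof (induction k rule: dec_induct)
  case base then show ?case by simp
next
  case (step k)
  have k: "2 \<le> Suc k" "Suc k \<le> n" using step by auto
  then have "i \<noteq> k" using pred_in_W[OF k] step by auto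
  from k show ?case
  proof (cases rule: W_cases)
    case two then show ?thesis using step by auto
  next
    case twin
    have "k \<noteq> j" "k \<noteq> i" using step \<open>i \<noteq> k\<close> by auto
    with twin step have "j = anchor k" by auto
    then show ?thesis using anchor_twin[of "Suc k"] twin k by simp
  next
    case (new a)
    then show ?thesis using anchor_new[of "Suc k" a] k step \<open>i \<noteq> k\<close> by auto
  qed
qed

text \<open>
  The test \<open>k \<le> anchor k\<close> only secures termination; it fails for \<open>2 \<le> k \<le> n\<close>.
\<close>

function dst :: "nat \<Rightarrow> nat \<Rightarrow> nat" where
  "dst u k = (if u = k then 0 else if k < u then dst k u
     else if u \<in> W k \<or> k \<le> anchor k then 1 else 1 + dst u (anchor k))"
  by pat_completeness auto
termination
  \<comment> \<open>Passing to the anchor lowers the sum; swapping the arguments keeps it but lowers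
    the second measure.\<close>
  by (relation "measures [\<lambda>(u, k). u + k, \<lambda>(u, k). if k < u then 1 else 0]") auto

section \<open>The recursive distance: Lipschitz bound and row recurrence\<close>

declare dst.simps [simp del]

lemma dst_same [simp]: "dst k k = 0"
  by (subst dst.simps) simp

lemma dst_greater: "k < u \<Longrightarrow> dst u k = dst k u"
  by (subst dst.simps) simp

lemma dst_commute: "dst u k = dst k u"
  by (metis dst_greater linorder_neqE_nat)

lemma dst_adj: "u \<in> W k \<Longrightarrow> 1 \<le> k \<Longrightarrow> k \<le> n \<Longrightarrow> dst u k = 1"
  using W_pos_less[of u k] by (subst dst.simps) simp

lemma dst_nonadj:
  assumes "u \<notin> W k" "1 \<le> u" "u < k" "k \<le> n"
  shows "dst u k = 1 + dst u (anchor k)"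
  using assms anchor_bounds[of k] by (subst dst.simps) simp

lemma dst_clique:
  assumes "1 \<le> k" "k \<le> n" "x \<in> W k" "y \<in> W k"
  shows "dst x y \<le> 1"
proof (cases x y rule: linorder_cases)
  case less
  then show ?thesis using dst_adj[OF W_clique[of k x y]] W_pos_less[of y k] assms by simp
next
  case greater
  then show ?thesis
    using dst_adj[OF W_clique[of k y x]] W_pos_less[of x k] assms by (simp add: dst_commute)
qed simp

text \<open>This makes \<open>dst\<close> to a fixed vertex a potential. The induction is on the
  larger of \<open>k\<close> and \<open>u\<close>, since \<open>dst\<close> replaces the larger
  argument by its anchor.\<close>

lemma dst_lipschitz:
  assumes "j \<in> W k" "1 \<le> k" "k \<le> n" "1 \<le> u" "u \<le> n"
  shows "dst u k \<le> dst u j + 1 \<and> dst u j \<le> dst u k + 1"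
  using assms
proof (induction "max k u" arbitrary: j k u rule: less_induct)
  case less
  note jk = W_pos_less[OF less.prems(1-3)]
  have k2: "2 \<le> k" using jk by simp
  note an = anchor_in[OF k2 \<open>k \<le> n\<close>] anchor_bounds[OF k2 \<open>k \<le> n\<close>]
  consider "u = k" | "u < k" "u \<in> W k" | "u < k" "u \<notin> W k" | "k < u" by linarith
  then show ?case
  proof cases
    case 1
    then show ?thesis using dst_adj[OF less.prems(1-3)] by (simp add: dst_commute)
  next
    case 2
    then show ?thesis using dst_adj[of u k] dst_clique[of k u j] less.prems by simp
  next
    case 3
    let ?a = "anchor k"
    have uk: "dst u k = 1 + dst u ?a" using dst_nonadj[of u k] 3 less.prems by simp
    show ?thesis
    proof (cases "j = ?a")
      case True then show ?thesis using uk by simp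
    next
      case False
      then have aj: "?a < j" using anchor_le[OF k2 \<open>k \<le> n\<close> less.prems(1)] by simp
      then have aWj: "?a \<in> W j" using W_clique[of k ?a j] an less.prems by simp
      have 1: "dst u j \<le> dst u ?a + 1"
        using less.hyps[of j u ?a] 3 jk aWj less.prems by simp
      have "u \<noteq> j" using 3 less.prems by auto
      have "u < j"
        using W_gap[of k j u] 3 less.prems False \<open>u \<noteq> j\<close> by (cases "u < j") simp_all
      have j: "2 \<le> j" "j \<le> n" "1 \<le> j" using aj an jk less.prems by auto
      \<comment> \<open>The Lipschitz bound between \<open>?a\<close> and \<open>j\<close> would be
        one too weak. But a non-neighbour \<open>u\<close> of \<open>j\<close> is reached through
        \<open>anchor j\<close>, which equals \<open>?a\<close> or, by the clique property, is
        adjacent to it.\<close>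
      have 2: "dst u ?a \<le> dst u j"
      proof (cases "u \<in> W j")
        case True
        then show ?thesis using dst_adj[of u j] dst_clique[of j u ?a] aWj j by simp
      next
        case False
        then have uj: "dst u j = 1 + dst u (anchor j)"
          using dst_nonadj[of u j] \<open>u < j\<close> less.prems j by simp
        show ?thesis
        proof (cases "anchor j = ?a")
          case False
          then have "anchor j < ?a" using anchor_le[OF j(1,2) aWj] by simp
          then have "anchor j \<in> W ?a" using W_clique[of j "anchor j" ?a] aWj j anchor_in[of j] by simp
          then show ?thesis using less.hyps[of ?a u "anchor j"] an 3 less.prems uj by simp
        qed (use uj in simp)
      qed
      show ?thesis using 1 2 uk by simp
    qed
  next
    case 4
    let ?b = "anchor u"
    have u2: "2 \<le> u" using 4 jk by simp
    note bn = anchor_in[OF u2 \<open>u \<le> n\<close>] anchor_bounds[OF u2 \<open>u \<le> n\<close>]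
    have nonadj: "dst u i = 1 + dst ?b i" if "i \<notin> W u" "1 \<le> i" "i < u" for i
      using dst_nonadj[OF that \<open>u \<le> n\<close>] by (simp add: dst_commute)
    have adj: "dst u i = 1" if "i \<in> W u" for i
      using dst_adj[OF that] less.prems by (simp add: dst_commute)
    \<comment> \<open>If only \<open>k\<close> is adjacent to \<open>u\<close>, then
      \<open>?b\<close> and \<open>j\<close> lie in the clique of \<open>k\<close> with its earlier
      neighbours. If only \<open>j\<close> is, the gap at \<open>k\<close> forces
      \<open>j = ?b\<close>. If neither is, both distances pass through \<open>?b\<close>.\<close>
    consider "k \<in> W u" "j \<in> W u" | "k \<in> W u" "j \<notin> W u" | "k \<notin> W u" "j \<in> W u"
      | "k \<notin> W u" "j \<notin> W u" by blast
    then show ?thesis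
    proof cases
      case 1 then show ?thesis using adj by simp
    next
      case 2
      have "dst ?b j \<le> 1"
      proof (cases "?b = k")
        case True then show ?thesis using dst_adj[of j k] less.prems by (simp add: dst_commute)
      next
        case False
        then have "?b < k" using anchor_le[OF u2 \<open>u \<le> n\<close> 2(1)] by simp
        then have "?b \<in> W k" using W_clique[of u ?b k] bn 2 less.prems by simp
        then show ?thesis using dst_clique[of k ?b j] less.prems by simp
      qed
      then show ?thesis using adj[OF 2(1)] nonadj[OF 2(2)] jk 4 by simp
    next
      case 3
      then have "j = ?b" using W_gap[of u j k] jk 4 less.prems by simp
      then have "dst ?b k = 1" using dst_adj[of ?b k] less.prems by simp
      then show ?thesis using adj[OF 3(2)] nonadj[OF 3(1)] 4 less.prems by simp
    next
      case none: 4
      then show ?thesis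
        using less.hyps[of k ?b j] nonadj[of k] nonadj[of j] bn jk 4 less.prems by simp
    qed
  qed
qed

lemma dst_recurrence:
  assumes "2 \<le> k" "k \<le> n"
  shows "\<exists>c s t :: real. 1 \<le> c \<and> c < k \<and> real (dst k c) = 1 \<and> t * t = 1 \<and>
     (\<forall>u\<in>{1..<k}. real (dst k u) = real (dst c u) + s + (if u = k - 1 then t else 0))"
  using assms
proof (cases rule: W_cases)
  case two
  have adj: "dst k 1 = 1" using dst_adj[of 1 k] two assms by (simp add: dst_commute)
  have "\<forall>u\<in>{1..<k}. real (dst k u) = real (dst 1 u) + 0 + (if u = k - 1 then 1 else 0)"
  proof
    fix u assume "u \<in> {1..<k}"
    then have "u = 1" "u = k - 1" using two by auto
    then show "real (dst k u) = real (dst 1 u) + 0 + (if u = k - 1 then 1 else 0)"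
      using adj by simp
  qed
  then show ?thesis using adj two(1)
    by - (rule exI[of _ 1], rule exI[of _ 0], rule exI[of _ 1], simp)
next
  case twin
  have adj: "dst k (k - 1) = 1" using dst_adj[OF pred_in_W] assms by (simp add: dst_commute)
  \<comment> \<open>Twins have the same older neighbours and the same anchor, hence equal distances
    to all older vertices.\<close>
  have "dst k u = dst (k - 1) u" if "1 \<le> u" "u < k - 1" for u
  proof (cases "u \<in> W k")
    case True
    then show ?thesis
      using dst_adj[of u k] dst_adj[of u "k - 1"] twin that assms by (simp add: dst_commute)
  next
    case False
    then show ?thesis
      using dst_nonadj[of u k] dst_nonadj[of u "k - 1"] anchor_twin twin that assms
      by (simp add: dst_commute)
  qed
  then have "\<forall>u\<in>{1..<k}. real (dst k u) = real (dst (k - 1) u) + 0 + (if u = k - 1 then 1 else 0)"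
    using adj twin by force
  then show ?thesis using adj twin(1)
    by - (rule exI[of _ "k - 1"], rule exI[of _ 0], rule exI[of _ 1], simp)
next
  case (new a)
  note a = anchor_new[OF new(1) assms(2) new(2,3)]
  have adj: "dst k a = 1" "dst k (k - 1) = 1" "dst a (k - 1) = 1"
    using dst_adj[of a k] dst_adj[of "k - 1" k] dst_adj[of a "k - 1"] new assms
    by (auto simp: dst_commute)
  have "dst k u = dst a u + 1" if "1 \<le> u" "u < k - 1" "u \<noteq> a" for u
    using dst_nonadj[of u k] new a that assms by (simp add: dst_commute)
  \<comment> \<open>Every other older vertex is reached through \<open>a\<close>; the vertex
    \<open>k - 1\<close> is adjacent to both \<open>a\<close> and \<open>k\<close>, which costs the
    correction -1.\<close>
  then have "\<forall>u\<in>{1..<k}. real (dst k u) = real (dst a u) + 1 + (if u = k - 1 then - 1 else 0)"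
    using adj new by force
  moreover have "1 \<le> a" using anchor_bounds[OF assms] a by simp
  ultimately show ?thesis using adj a(2)
    by - (rule exI[of _ a], rule exI[of _ 1], rule exI[of _ "- 1"], simp)
qed

section \<open>The graph distance equals the recursive distance\<close>

abbreviation path_graph :: "nat pair_pre_digraph" where
  "path_graph \<equiv> neighborhood_graph n W"

lemma pverts_path_graph: "pverts path_graph = {1..n}"
  by (simp add: neighborhood_graph_def)

lemma arc_iff: "(u, v) \<in> parcs path_graph \<longleftrightarrow> (u \<in> {1..n} \<and> v \<in> W u) \<or> (v \<in> {1..n} \<and> u \<in> W v)"
  by (auto simp: neighborhood_graph_def)

lemma wf_path_graph: "wf_digraph (with_proj path_graph)"
proof
  fix e assume "e \<in> arcs (with_proj path_graph)"
  then obtain u v where e: "e = (u, v)" "(u, v) \<in> parcs path_graph"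
    by (metis surj_pair with_proj_simps(2))
  have "u \<in> {1..n} \<and> v \<in> {1..n}"
    using e(2) unfolding arc_iff using W_pos_less[of u v] W_pos_less[of v u] by auto
  then show "tail (with_proj path_graph) e \<in> verts (with_proj path_graph)" "head (with_proj path_graph) e \<in> verts (with_proj path_graph)"
    by (simp_all add: pverts_path_graph e(1))
qed

text \<open>The recursion of \<open>dst\<close> unfolds into a walk through anchors. Walks are
  directed, so the arc is appended if \<open>k\<close> is the later end and prepended if
  \<open>u\<close> is.\<close>

lemma walk_of_length_dst:
  assumes "u \<in> {1..n}" "k \<in> {1..n}"
  shows "\<exists>p. pre_digraph.awalk (with_proj path_graph) u p k \<and> length p = dst u k"
proof -
  interpret wf_digraph "with_proj path_graph" by (rule wf_path_graph)
  have arc: "awalk i [(i, j)] j" "awalk j [(j, i)] i" if "j \<in> W i" "i \<in> {1..n}" for i j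
  proof -
    have "(i, j) \<in> parcs path_graph" "(j, i) \<in> parcs path_graph" using that by (auto simp only: arc_iff)
    then show "awalk i [(i, j)] j" "awalk j [(j, i)] i"
      using arc_implies_awalk[of "(i, j)"] arc_implies_awalk[of "(j, i)"] by simp_all
  qed
  show ?thesis using assms
  proof (induction "max u k" arbitrary: u k rule: less_induct)
    case less
    consider "u = k" | "u < k" | "k < u" by linarith
    then show ?case
    proof cases
      case 1
      have "awalk u [] u" using less.prems by (simp add: awalk_Nil_iff pverts_path_graph)
      then show ?thesis using 1 dst_same by (metis list.size(3))
    next
      case 2
      show ?thesis
      proof (cases "u \<in> W k")
        case True
        then have "length [(u, k)] = dst u k" using dst_adj[of u k] less.prems by simp
        then show ?thesis using arc(2)[OF True less.prems(2)] by metis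
      next
        case False
        let ?a = "anchor k"
        have a: "?a \<in> W k" "1 \<le> ?a" "?a < k"
          using anchor_in[of k] anchor_bounds[of k] 2 less.prems by auto
        then obtain p where p: "awalk u p ?a" "length p = dst u ?a"
          using less.hyps[of u ?a] 2 less.prems by auto
        have "length (p @ [(?a, k)]) = dst u k"
          using dst_nonadj[OF False] 2 less.prems p(2) by simp
        then show ?thesis using awalk_appendI[OF p(1) arc(2)[OF a(1) less.prems(2)]] by metis
      qed
    next
      case 3
      show ?thesis
      proof (cases "k \<in> W u")
        case True
        then have "length [(u, k)] = dst u k"
          using dst_adj[of k u] less.prems by (simp add: dst_commute)
        then show ?thesis using arc(1)[OF True less.prems(1)] by metis
      next
        case False
        let ?a = "anchor u"
        have a: "?a \<in> W u" "1 \<le> ?a" "?a < u"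
          using anchor_in[of u] anchor_bounds[of u] 3 less.prems by auto
        then obtain p where p: "awalk ?a p k" "length p = dst ?a k"
          using less.hyps[of ?a k] 3 less.prems by auto
        have "length ([(u, ?a)] @ p) = dst u k"
          using dst_nonadj[OF False] 3 less.prems p(2) by (simp add: dst_commute)
        then show ?thesis using awalk_appendI[OF arc(1)[OF a(1) less.prems(1)] p(1)] by metis
      qed
    qed
  qed
qed

lemma graph_distance_eq_dst:
  assumes "u \<in> {1..n}" "v \<in> {1..n}"
  shows "graph_distance path_graph u v = real (dst u v)"
proof -
  interpret wf_digraph "with_proj path_graph" by (rule wf_path_graph)
  obtain p where p: "awalk u p v" "length p = dst u v"
    using walk_of_length_dst[OF assms] by auto
  have lip: "dst (tail (with_proj path_graph) e) v \<le> dst (head (with_proj path_graph) e) v + 1"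
    if "e \<in> arcs (with_proj path_graph)" for e
    using that dst_lipschitz[of "fst e" "snd e" v] dst_lipschitz[of "snd e" "fst e" v] assms arc_iff
    by (cases e) (auto simp: dst_commute[of v])
  have "dst u v \<le> length q" if "awalk u q v" for q
    using potential_le_awalk_length[of "\<lambda>x. dst x v", OF lip that] by simp
  then show ?thesis unfolding graph_distance_def by (rule \<mu>_unit_eqI[OF p])
qed

end

lemma two_seq_steps:
  assumes "1 \<le> i" "Suc i < length (two_seq ps)"
  shows "two_seq ps ! Suc i = 2 \<or> two_seq ps ! Suc i = Suc (two_seq ps ! i)"
proof -
  \<comment> \<open>Each block starts at 2 and grows by one, so \<open>P\<close> survives appending
    an entry. List index \<open>Suc i\<close> with \<open>i \<ge> 1\<close> holds $q_{i+2}$.\<close>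
  define P :: "nat list \<Rightarrow> bool" where
    "P s \<longleftrightarrow> s \<noteq> [] \<and> (\<forall>i\<ge>1. Suc i < length s \<longrightarrow> s ! Suc i = 2 \<or> s ! Suc i = Suc (s ! i))" for s
  have snoc: "P (s @ [q])" if "P s" "q = 2 \<or> q = Suc (last s)" for s q
    unfolding P_def
  proof (intro conjI allI impI)
    fix i assume i: "1 \<le> i" "Suc i < length (s @ [q])"
    show "(s @ [q]) ! Suc i = 2 \<or> (s @ [q]) ! Suc i = Suc ((s @ [q]) ! i)"
    proof (cases "Suc i = length s")
      case True
      then have "last s = s ! i" using that(1) by (simp add: P_def last_conv_nth flip: True)
      then show ?thesis using that(2) True by (auto simp: nth_append simp flip: True)
    qed (use that(1) i in \<open>auto simp: P_def nth_append\<close>)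
  qed simp
  have upt: "P (s @ [2..<p])" if "P s" for s p
  proof (induction p)
    case (Suc p)
    show ?case
    proof (cases "2 \<le> p")
      case True
      have "p = 2 \<or> p = Suc (last (s @ [2..<p]))"
        using True by (cases "p = 2") (auto simp: last_append)
      then show ?thesis using snoc[OF Suc] True by simp
    qed (use that in simp)
  qed (use that in simp)
  have "P (two_seq ps)"
  proof (induction ps rule: rev_induct)
    case Nil
    show ?case by (simp add: P_def two_seq_def)
  next
    case (snoc p ps)
    then show ?case using upt[of "two_seq ps" p] by (simp add: two_seq_def)
  qed
  then show ?thesis using assms by (simp add: P_def)
qed

text \<open>If $q_k = 2$ then $b_k = k - 1$ and a new clique starts; if $q_k = q_{k-1} + 1$ then
  $b_k = b_{k-1}$ and \<open>k\<close> is a twin.\<close>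

lemma clique_path_two_seq:
  assumes "neighborhood_sequence (two_seq ps) W"
  shows "clique_path (length (two_seq ps)) W"
proof
  let ?s = "two_seq ps"
  show "W 1 = {}" "W 2 = {1}" using assms by (auto simp: neighborhood_sequence_def)
  have nl: "non_leaping ?s" using assms by (simp add: neighborhood_sequence_def)
  fix k assume k: "3 \<le> k" "k \<le> length ?s"
  let ?b = "seq_b ?s k"
  have nb: "\<exists>a. a \<in> W (i - 1) \<and> a < seq_b ?s i \<and> W i = {a} \<union> {seq_b ?s i..i - 1}"
    if "3 \<le> i" "i \<le> length ?s" for i
    using assms that by (simp add: neighborhood_sequence_def)
  from nb[OF k] obtain a where a: "a \<in> W (k - 1)" "a < ?b" "W k = {a} \<union> {?b..k - 1}" by blast
  have q2: "2 \<le> seq_entry ?s k" using nl k by (simp add: non_leaping_def)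
  show "W k = insert (k - 1) (W (k - 1)) \<or> (\<exists>a\<in>W (k - 1). W k = {a, k - 1})"
  proof (cases "seq_entry ?s k = 2")
    case True
    then have "?b = k - 1" by (simp add: seq_b_def)
    then show ?thesis using a by auto
  next
    case False
    have "Suc (k - 2) = k - 1" using k by simp
    then have q: "seq_entry ?s k = Suc (seq_entry ?s (k - 1))"
      using two_seq_steps[of "k - 2" ps] False k by (simp add: seq_entry_def numeral_2_eq_2)
    \<comment> \<open>Otherwise $q_3 = q_2 + 1 = 2$; hence \<open>k - 1\<close> is itself subject to
      the neighborhood rule.\<close>
    have "k \<noteq> 3"
      using q False nl by (auto simp: non_leaping_def)
    then have k': "3 \<le> k - 1" "k - 1 \<le> length ?s" using k by auto
    have b: "seq_b ?s (k - 1) = ?b" using q k by (simp add: seq_b_def)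
    \<comment> \<open>The only element of \<open>W (k - 1)\<close> below \<open>?b\<close> is
      \<open>a'\<close>, so \<open>a = a'\<close>.\<close>
    from nb[OF k'] obtain a' where "a' < ?b" "W (k - 1) = {a'} \<union> {?b..k - 1 - 1}"
      unfolding b by blast
    moreover have "{?b..k - 1} = insert (k - 1) {?b..k - 1 - 1}"
      using q2 k by (auto simp: seq_b_def)
    ultimately show ?thesis using a by auto
  qed
qed

theorem theorem4p6:
  fixes ps :: "nat list" and G :: "nat pair_pre_digraph" and n :: nat
  assumes "\<forall>p\<in>set ps. 3 \<le> p"
    and "G \<in> CP (two_seq ps)"
    and "n = card (pverts G)"
  shows "cof (distance_matrix G) = (-1) ^ (n - 1) * real n"
proof -
  from assms(2) obtain W where W: "neighborhood_sequence (two_seq ps) W"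
    and G: "G = neighborhood_graph (length (two_seq ps)) W"
    by (auto simp: CP_def)
  have n: "n = length (two_seq ps)" using assms(3) CP_pair_graph(2)[OF assms(2)] by simp
  interpret clique_path n W unfolding n by (rule clique_path_two_seq[OF W])
  have "distance_matrix G = mat n n (\<lambda>(i, j). real (dst (i + 1) (j + 1)))"
    using graph_distance_eq_dst
    by (intro eq_matI) (auto simp: distance_matrix_def G n[symmetric] pverts_path_graph)
  moreover have "1 \<le> n" by (simp add: n two_seq_def)
  ultimately show ?thesis
    using cof_of_row_recurrence[of "\<lambda>i j. real (dst i j)" n] dst_recurrence dst_commute by simp
qed

end
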